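(* Let $\xi\in L^\infty(D;\mathbb{C}^{d\times d})$ be a Hermitian $d$-by-$d$ tensor field with (real) eigenvalues $\lambda_1(\mathbf{x}),\dots,\lambda_d(\mathbf{x})$. The tensor field $\xi$ is elliptic if and only if the eigenvalues are either all strictly positive a.e. in $D$ or all strictly negative a.e. in $D$, and there exist $\xi_+,\xi_->0$ such that, for almost every $\mathbf{x}\in D$, $|\lambda_i(\mathbf{x})|\in[\xi_-,\xi_+]$ for $i=1,\dots,d$. Moreover, when $\xi$ is elliptic, $\Theta_\xi=\,]-\pi/2,\pi/2[$ if the eigenvalues are positive, and $\Theta_\xi=[-\pi,-\pi/2[\,\cup\,]\pi/2,\pi]$ if they are negative.
   Context: $D\subset\mathbb{R}^3$ is a bounded measurable set of positive measure and $d\in\{1,2,3\}$. $L^\infty(D;\mathbb{C}^{d\times d})$ is the space of measurable complex $d$-by-$d$ tensor (matrix) fields $\xi$ with $\operatorname{ess\,sup}_{\mathbf{x}\in D}\sup_{\mathbf{z}\in\mathbb{C}^d\setminus\{0\}}|\xi(\mathbf{x})\mathbf{z}|/|\mathbf{z}|<\infty$. The field is Hermitian if $\xi(\mathbf{x})$ is a Hermitian matrix for (almost every) $\mathbf{x}\in D$. The field $\xi$ is elliptic if there exist $\theta_\xi\in\mathbb{R}$ and $\xi_->0$ such that, for almost every $\mathbf{x}\in D$ and all $\mathbf{z}\in\mathbb{C}^d$, $\mathrm{Re}\{e^{i\theta_\xi}(\xi(\mathbf{x})\mathbf{z})\cdot\overline{\mathbf{z}}\}\ge\xi_-|\mathbf{z}|^2$.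 An ellipticity direction of $\xi$ is an angle $\theta_\xi\in\mathbb{R}$ for which such a $\xi_->0$ exists, and $\Theta_\xi$ denotes the set of all ellipticity directions of $\xi$ in $[-\pi,\pi]$. *)

theory Defs
  imports "HOL-Analysis.Analysis" "HOL-Probability.Essential_Supremum"
begin

text \<open>Tensor fields are total functions on \<open>\<real>\<^sup>3\<close>; only their values on \<open>D\<close> matter, since
  all conditions refer to Lebesgue measure restricted to \<open>D\<close>. The dimension \<open>d\<close> is \<open>CARD('d)\<close>.\<close>

definition matrix_sup_ratio :: "complex^'d^'d \<Rightarrow> ereal" where
  "matrix_sup_ratio A = (SUP z\<in>{z. z \<noteq> 0}. ereal (norm (A *v z) / norm z))"

definition Linf_tensor :: "(real^3) set \<Rightarrow> (real^3 \<Rightarrow> complex^'d^'d) set" where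
  "Linf_tensor D = {\<xi> \<in> borel_measurable (lebesgue_on D).
     esssup (lebesgue_on D) (\<lambda>x. matrix_sup_ratio (\<xi> x)) < \<infinity>}"

definition hermitian_matrix :: "complex^'d^'d \<Rightarrow> bool" where
  "hermitian_matrix A \<longleftrightarrow> (\<forall>i j. A $ i $ j = cnj (A $ j $ i))"

definition hermitian_field :: "(real^3) set \<Rightarrow> (real^3 \<Rightarrow> complex^'d^'d) \<Rightarrow> bool" where
  "hermitian_field D \<xi> \<longleftrightarrow> (AE x in lebesgue_on D. hermitian_matrix (\<xi> x))"

text \<open>The bilinear (unconjugated) dot product; the inner product of the library on
  \<open>complex^'d\<close> is real-valued.\<close>

definition cdot :: "complex^'d \<Rightarrow> complex^'d \<Rightarrow> complex" where
  "cdot u v = (\<Sum>i\<in>UNIV. u $ i * v $ i)"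

definition cnj_vec :: "complex^'d \<Rightarrow> complex^'d" where
  "cnj_vec z = (\<chi> i. cnj (z $ i))"

definition ellipticity_direction ::
    "(real^3) set \<Rightarrow> (real^3 \<Rightarrow> complex^'d^'d) \<Rightarrow> real \<Rightarrow> bool" where
  "ellipticity_direction D \<xi> \<theta> \<longleftrightarrow>
     (\<exists>c>0. AE x in lebesgue_on D. \<forall>z.
        Re (exp (\<i> * of_real \<theta>) * cdot (\<xi> x *v z) (cnj_vec z)) \<ge> c * (norm z)\<^sup>2)"

definition elliptic :: "(real^3) set \<Rightarrow> (real^3 \<Rightarrow> complex^'d^'d) \<Rightarrow> bool" where
  "elliptic D \<xi> \<longleftrightarrow> (\<exists>\<theta>. ellipticity_direction D \<xi> \<theta>)"

definition ellipticity_directions ::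
    "(real^3) set \<Rightarrow> (real^3 \<Rightarrow> complex^'d^'d) \<Rightarrow> real set" where
  "ellipticity_directions D \<xi> = {\<theta> \<in> {-pi..pi}. ellipticity_direction D \<xi> \<theta>}"

text \<open>The family \<open>l\<close> lists the eigenvalues of \<open>A\<close> with algebraic multiplicity: the
  characteristic polynomial of \<open>A\<close> is the product of the linear factors \<open>t - l i\<close>.\<close>

definition eigenvalues_of :: "complex^'d^'d \<Rightarrow> ('d \<Rightarrow> complex) \<Rightarrow> bool" where
  "eigenvalues_of A l \<longleftrightarrow> (\<forall>t. det (mat t - A) = (\<Prod>i\<in>UNIV. (t - l i)))"

end

theory Submission
  imports Defs
begin

text \<open>For a Hermitian matrix \<open>A\<close> the form \<open>z \<mapsto> A z \<cdot> cnj z\<close> is real, so an angle \<open>\<theta>\<close> enters the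
  ellipticity condition only through \<open>cos \<theta>\<close>. The form \<open>cos \<theta> (A z \<cdot> cnj z)\<close> attains its minimum
  over the unit sphere at an eigenvector, the minimum being the least of the numbers
  \<open>cos \<theta> \<lambda>\<^sub>i\<close>. Hence \<open>\<theta>\<close> is an ellipticity direction iff the functions \<open>cos \<theta> \<lambda>\<^sub>i\<close> are bounded
  below by a common positive constant.\<close>

section \<open>Least eigenvalue of a self-adjoint map\<close>

text \<open>By compactness the Rayleigh quotient has a minimiser \<open>v\<close> on the unit
  sphere, and a minimiser must be an eigenvector. Real scalars suffice, so \<open>complex^'d\<close>
  is covered as a real inner product space.\<close>

lemma selfadjoint_least_eigenvector:
  fixes f :: "'a::euclidean_space \<Rightarrow> 'a"
  assumes "linear f" and sa: "\<And>u v. f u \<bullet> v = u \<bullet> f v"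
  obtains v m where "norm v = 1" "f v = m *\<^sub>R v" "\<And>z. m * (norm z)\<^sup>2 \<le> f z \<bullet> z"
proof -
  interpret linear f by fact
  have "continuous_on (sphere 0 1) (\<lambda>z. f z \<bullet> z)"
    using \<open>linear f\<close> by (intro continuous_intros linear_continuous_on linear_conv_bounded_linear[THEN iffD1])
  moreover obtain b :: 'a where "norm b = 1"
    using vector_choose_size[of 1] by auto
  ultimately obtain v where v: "norm v = 1" and min: "\<And>z. norm z = 1 \<Longrightarrow> f v \<bullet> v \<le> f z \<bullet> z"
    using continuous_attains_inf[of "sphere 0 1" "\<lambda>z. f z \<bullet> z"] by fastforce
  define m where "m = f v \<bullet> v"
  have low: "m * (norm z)\<^sup>2 \<le> f z \<bullet> z" for z
  proof (cases "z = 0")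
    case False
    have "m \<le> f (z /\<^sub>R norm z) \<bullet> (z /\<^sub>R norm z)"
      unfolding m_def using False by (intro min) simp
    also have "\<dots> = (f z \<bullet> z) / (norm z)\<^sup>2"
      by (simp add: scale power2_eq_square divide_inverse)
    finally show ?thesis
      using False by (simp add: field_simps)
  qed (simp add: zero)
  define w where "w = f v - m *\<^sub>R v"
  define K where "K = f w \<bullet> w - m * (w \<bullet> w)"
  \<comment> \<open>\<open>f - m\<close> is positive semidefinite and its form vanishes at \<open>v\<close>; perturbing \<open>v\<close>
    in the direction of \<open>- w\<close> forces \<open>w = 0\<close>.\<close>
  have quad: "0 \<le> t * (t * K - 2 * (w \<bullet> w))" for t
  proof -
    have "m * ((v - t *\<^sub>R w) \<bullet> (v - t *\<^sub>R w)) \<le> f (v - t *\<^sub>R w) \<bullet> (v - t *\<^sub>R w)"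
      using low by (simp add: power2_norm_eq_inner)
    \<comment> \<open>Both cross terms come from \<open>f v = w + m *\<^sub>R v\<close>, the first
      one through symmetry of \<open>f\<close>; their parts in \<open>m\<close> cancel against the
      left-hand side.\<close>
    moreover have "f w \<bullet> v = w \<bullet> w + m * (v \<bullet> w)" "f v \<bullet> w = w \<bullet> w + m * (v \<bullet> w)"
      unfolding sa[of w v] by (simp_all add: w_def inner_commute algebra_simps)
    moreover have "v \<bullet> v = 1" "f v \<bullet> v = m"
      using v by (simp_all add: m_def norm_eq_1)
    ultimately show ?thesis
      by (simp add: K_def diff scale inner_diff_left inner_diff_right inner_commute algebra_simps)
  qed
  have "K \<ge> 0"
    using low[of w] by (simp add: K_def power2_norm_eq_inner)
  have "w \<bullet> w = 0"
  proof (rule ccontr)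
    assume "w \<bullet> w \<noteq> 0"
    then have p: "w \<bullet> w > 0"
      by simp
    \<comment> \<open>The denominator is \<open>K + 1\<close> because \<open>K\<close> may vanish.
      This \<open>t\<close> makes the second factor in \<open>quad\<close> at most
      \<open>- (w \<bullet> w)\<close>, hence negative.\<close>
    define t where "t = (w \<bullet> w) / (K + 1)"
    have "t > 0" "t * K \<le> w \<bullet> w"
      using p \<open>K \<ge> 0\<close> by (auto simp: t_def field_simps)
    then show False
      using quad[of t] p by (simp add: zero_le_mult_iff)
  qed
  then have "f v = m *\<^sub>R v"
    by (simp add: w_def)
  with v low that show ?thesis by blast
qed

section \<open>Hermitian forms and eigenvalues\<close>

lemma Re_cdot_cnj_vec: "Re (cdot u (cnj_vec v)) = u \<bullet> v"
  by (simp add: cdot_def cnj_vec_def inner_vec_def inner_complex_def)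

lemma cdot_cnj_vec_commute: "cdot u (cnj_vec v) = cnj (cdot v (cnj_vec u))"
  by (simp add: cdot_def cnj_vec_def mult.commute)

lemma hermitian_cdot:
  assumes "hermitian_matrix A"
  shows "cdot (A *v u) (cnj_vec v) = cdot u (cnj_vec (A *v v))"
proof -
  have "cdot (A *v u) (cnj_vec v) = (\<Sum>i\<in>UNIV. \<Sum>j\<in>UNIV. A $ i $ j * u $ j * cnj (v $ i))"
    by (simp add: cdot_def cnj_vec_def matrix_vector_mult_def sum_distrib_right)
  also have "\<dots> = (\<Sum>j\<in>UNIV. \<Sum>i\<in>UNIV. A $ i $ j * u $ j * cnj (v $ i))"
    by (rule sum.swap)
  also have "\<dots> = (\<Sum>j\<in>UNIV. \<Sum>i\<in>UNIV. u $ j * (cnj (A $ j $ i) * cnj (v $ i)))"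
  proof (intro sum.cong refl)
    fix i j
    have "A $ i $ j = cnj (A $ j $ i)"
      using assms unfolding hermitian_matrix_def by blast
    then show "A $ i $ j * u $ j * cnj (v $ i) = u $ j * (cnj (A $ j $ i) * cnj (v $ i))"
      by (simp only: ac_simps)
  qed
  also have "\<dots> = cdot u (cnj_vec (A *v v))"
    by (simp add: cdot_def cnj_vec_def matrix_vector_mult_def sum_distrib_left)
  finally show ?thesis .
qed

text \<open>The form of a Hermitian matrix equals its own conjugate, hence is real, so only the real
  part of the exponential contributes.\<close>

lemma Re_exp_hermitian_form:
  assumes "hermitian_matrix A"
  shows "Re (exp (\<i> * of_real \<theta>) * cdot (A *v z) (cnj_vec z)) = cos \<theta> * ((A *v z) \<bullet> z)"
proof -
  have "cdot (A *v z) (cnj_vec z) = cnj (cdot (A *v z) (cnj_vec z))"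
    by (subst hermitian_cdot[OF assms]) (rule cdot_cnj_vec_commute)
  from arg_cong[OF this, of Im] have "Im (cdot (A *v z) (cnj_vec z)) = 0"
    by simp
  then show ?thesis
    by (simp add: Re_cdot_cnj_vec Re_exp)
qed

text \<open>The roots of the product are exactly the \<open>l i\<close>, and a vanishing determinant
  means a nontrivial kernel. This ties the characteristic polynomial to eigenvectors.\<close>

lemma eigenvalues_of_iff:
  fixes A :: "complex^'d^'d"
  assumes "eigenvalues_of A l"
  shows "(\<exists>i. t = l i) \<longleftrightarrow> (\<exists>v. v \<noteq> 0 \<and> A *v v = t *s v)"
proof -
  have "(\<exists>i. t = l i) \<longleftrightarrow> det (mat t - A) = 0"
    using assms by (auto simp: eigenvalues_of_def)
  also have "\<dots> \<longleftrightarrow> (\<exists>v. v \<noteq> 0 \<and> (mat t - A) *v v = 0)"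
    using invertible_det_nz[of "mat t - A"] invertible_left_inverse[of "mat t - A"]
      matrix_left_invertible_ker[of "mat t - A"] by blast
  also have "\<dots> \<longleftrightarrow> (\<exists>v. v \<noteq> 0 \<and> A *v v = t *s v)"
  proof -
    have "mat t *v v = t *s v" for v :: "complex^'d"
      by (simp add: vec_eq_iff matrix_vector_mult_def mat_def if_distrib if_distribR cong: if_cong)
    then show ?thesis
      by (auto simp: matrix_vector_mult_diff_rdistrib)
  qed
  finally show ?thesis .
qed

lemma of_real_vector_scalar_mult: "complex_of_real r *s v = r *\<^sub>R v"
  unfolding vec_eq_iff vector_smult_component vector_scaleR_component by (simp add: scaleR_conv_of_real)

lemma real_eigenvector:
  assumes "eigenvalues_of A (\<lambda>i. complex_of_real (l i))"
  obtains v where "v \<noteq> 0" "A *v v = l i *\<^sub>R v"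
  using eigenvalues_of_iff[OF assms, of "complex_of_real (l i)"] that
  by (auto simp: of_real_vector_scalar_mult)

text \<open>Testing the form on an eigenvector for \<open>l i\<close> gives one direction; the
  converse bounds it below by the least eigenvalue of \<open>cos \<theta> *\<^sub>R A\<close>. The
  same \<open>c\<close> appears on both sides.\<close>

lemma hermitian_coercive_iff:
  fixes A :: "complex^'d^'d"
  assumes A: "hermitian_matrix A" and l: "eigenvalues_of A (\<lambda>i. complex_of_real (l i))"
  shows "(\<forall>z. c * (norm z)\<^sup>2 \<le> Re (exp (\<i> * of_real \<theta>) * cdot (A *v z) (cnj_vec z)))
    \<longleftrightarrow> (\<forall>i. c \<le> cos \<theta> * l i)"
proof (intro iffI allI)
  fix i
  assume *: "\<forall>z. c * (norm z)\<^sup>2 \<le> Re (exp (\<i> * of_real \<theta>) * cdot (A *v z) (cnj_vec z))"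
  obtain v where "v \<noteq> 0" "A *v v = l i *\<^sub>R v"
    using real_eigenvector[OF l] .
  then have "c * (norm v)\<^sup>2 \<le> (cos \<theta> * l i) * (norm v)\<^sup>2"
    using *[rule_format, of v] unfolding Re_exp_hermitian_form[OF A]
    by (simp add: power2_norm_eq_inner)
  then show "c \<le> cos \<theta> * l i"
    using \<open>v \<noteq> 0\<close> by simp
next
  fix z :: "complex^'d"
  assume *: "\<forall>i. c \<le> cos \<theta> * l i"
  define f where "f z = cos \<theta> *\<^sub>R (A *v z)" for z
  have "linear f"
    unfolding f_def
    by (intro bounded_linear.linear bounded_linear_compose[OF bounded_linear_scaleR_right]
        matrix_vector_mul_bounded_linear)
  moreover have "f u \<bullet> v = u \<bullet> f v" for u v
  proof -
    have "(A *v u) \<bullet> v = u \<bullet> (A *v v)"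
      using hermitian_cdot[OF A] by (simp flip: Re_cdot_cnj_vec)
    then show ?thesis
      by (simp add: f_def)
  qed
  ultimately obtain v m where v: "norm v = 1" "f v = m *\<^sub>R v"
    and m: "m * (norm z)\<^sup>2 \<le> f z \<bullet> z"
    using selfadjoint_least_eigenvector by blast
  have "c \<le> m"
  proof (cases "cos \<theta> = 0")
    \<comment> \<open>Here \<open>f\<close> is the zero map, so \<open>m = 0\<close>, while the
      hypothesis reads \<open>c \<le> 0\<close>.\<close>
    case True
    then show ?thesis
      using v * by (auto simp: f_def)
  next
    case False
    \<comment> \<open>Dividing by the nonzero cosine turns an eigenvector of \<open>f\<close> into
      one of \<open>A\<close>, so that \<open>m\<close> is \<open>cos \<theta>\<close> times some
      \<open>l i\<close>.\<close>
    have "A *v v = complex_of_real (m / cos \<theta>) *s v"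
      using arg_cong[OF v(2), of "\<lambda>u. u /\<^sub>R cos \<theta>"] False
      unfolding of_real_vector_scalar_mult by (simp add: f_def divide_inverse mult.commute)
    moreover have "v \<noteq> 0"
      using v by auto
    ultimately obtain i where "complex_of_real (m / cos \<theta>) = complex_of_real (l i)"
      using eigenvalues_of_iff[OF l] by blast
    then have "m = cos \<theta> * l i"
      using False by (simp only: of_real_eq_iff) (simp add: field_simps)
    with * show ?thesis
      by simp
  qed
  then have "c * (norm z)\<^sup>2 \<le> f z \<bullet> z"
    using m mult_right_mono[of c m "(norm z)\<^sup>2"] by simp
  then show "c * (norm z)\<^sup>2 \<le> Re (exp (\<i> * of_real \<theta>) * cdot (A *v z) (cnj_vec z))"
    unfolding Re_exp_hermitian_form[OF A] by (simp add: f_def)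
qed

section \<open>From pointwise bounds to tensor fields\<close>

lemma ellipticity_direction_iff:
  assumes "hermitian_field D \<xi>"
    and "AE x in lebesgue_on D. eigenvalues_of (\<xi> x) (\<lambda>i. complex_of_real (l i x))"
  shows "ellipticity_direction D \<xi> \<theta> \<longleftrightarrow> (\<exists>c>0. AE x in lebesgue_on D. \<forall>i. c \<le> cos \<theta> * l i x)"
proof -
  have "(AE x in lebesgue_on D. \<forall>z.
          Re (exp (\<i> * of_real \<theta>) * cdot (\<xi> x *v z) (cnj_vec z)) \<ge> c * (norm z)\<^sup>2)
      \<longleftrightarrow> (AE x in lebesgue_on D. \<forall>i. c \<le> cos \<theta> * l i x)" for c
  proof (rule eventually_subst)
    show "AE x in lebesgue_on D. (\<forall>z.
          Re (exp (\<i> * of_real \<theta>) * cdot (\<xi> x *v z) (cnj_vec z)) \<ge> c * (norm z)\<^sup>2)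
      = (\<forall>i. c \<le> cos \<theta> * l i x)"
      using assms unfolding hermitian_field_def by eventually_elim (rule hermitian_coercive_iff)
  qed
  then show ?thesis
    by (simp add: ellipticity_direction_def)
qed

lemma norm_le_matrix_sup_ratio:
  assumes "matrix_sup_ratio A \<le> ereal C"
  shows "norm (A *v z) \<le> C * norm z"
proof (cases "z = 0")
  case False
  then have "ereal (norm (A *v z) / norm z) \<le> matrix_sup_ratio A"
    unfolding matrix_sup_ratio_def by (intro SUP_upper) auto
  also note assms
  finally show ?thesis
    using False by (simp add: field_simps)
qed simp

text \<open>An eigenvector is stretched by exactly the modulus of its eigenvalue, which therefore
  cannot exceed the essential supremum of the operator norms.\<close>

lemma Linf_tensor_eigenvalues_bounded:
  assumes "\<xi> \<in> Linf_tensor D"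
    and "AE x in lebesgue_on D. eigenvalues_of (\<xi> x) (\<lambda>i. complex_of_real (l i x))"
  obtains C where "C > 0" "AE x in lebesgue_on D. \<forall>i. \<bar>l i x\<bar> \<le> C"
proof -
  define S where "S = esssup (lebesgue_on D) (\<lambda>x. matrix_sup_ratio (\<xi> x))"
  have "S < \<infinity>"
    using assms(1) by (simp add: Linf_tensor_def S_def)
  \<comment> \<open>The maximum with 1 makes \<open>C\<close> positive and also covers
    \<open>S\<close> being minus infinity.\<close>
  then obtain C where C: "S \<le> ereal C" "C > 0"
    using that[of "max 1 (real_of_ereal S)"] by (cases S) auto
  have "AE x in lebesgue_on D. matrix_sup_ratio (\<xi> x) \<le> S"
    unfolding S_def by (rule esssup_AE)
  with assms(2) have "AE x in lebesgue_on D. \<forall>i. \<bar>l i x\<bar> \<le> C"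
  proof eventually_elim
    case (elim x)
    show ?case
    proof
      fix i
      obtain v where v: "v \<noteq> 0" "\<xi> x *v v = l i x *\<^sub>R v"
        using real_eigenvector[OF elim(1)] .
      have "norm (\<xi> x *v v) \<le> C * norm v"
        using elim(2) C(1) by (intro norm_le_matrix_sup_ratio) (rule order_trans)
      then show "\<bar>l i x\<bar> \<le> C"
        using v by simp
    qed
  qed
  with C(2) that show ?thesis by blast
qed

text \<open>Positive measure turns a pointwise contradiction holding almost everywhere into an
  actual one.\<close>

lemma not_AE_False_lebesgue_on:
  assumes "D \<in> sets lebesgue" and "emeasure lebesgue D > 0"
  shows "\<not> (AE x in lebesgue_on D. False)"
  using assms by (simp add: AE_iff_measurable[OF sets.top] emeasure_restrict_space space_restrict_space)

text \<open>Cosine is even and decreasing on \<open>{0..pi}\<close>, so its sign is decided by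
  comparing \<open>\<bar>x\<bar>\<close> with its zero \<open>pi/2\<close>.\<close>

lemma cos_pos_interval: "{x \<in> {-pi..pi}. 0 < cos x} = {-pi/2<..<pi/2}"
proof (rule set_eqI)
  fix x
  have "0 < cos x \<longleftrightarrow> \<bar>x\<bar> < pi / 2" if "\<bar>x\<bar> \<le> pi"
    using that cos_mono_less_eq[of "pi/2" "\<bar>x\<bar>"] by simp
  moreover have "x \<in> {-pi/2<..<pi/2} \<longleftrightarrow> \<bar>x\<bar> < pi / 2" "x \<in> {-pi..pi} \<longleftrightarrow> \<bar>x\<bar> \<le> pi"
    by auto
  ultimately show "x \<in> {x \<in> {-pi..pi}. 0 < cos x} \<longleftrightarrow> x \<in> {-pi/2<..<pi/2}"
    using pi_gt_zero unfolding mem_Collect_eq by linarith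
qed

lemma cos_neg_interval: "{x \<in> {-pi..pi}. cos x < 0} = {-pi..<-pi/2} \<union> {pi/2<..pi}"
proof (rule set_eqI)
  fix x
  have "cos x < 0 \<longleftrightarrow> pi / 2 < \<bar>x\<bar>" if "\<bar>x\<bar> \<le> pi"
    using that cos_mono_less_eq[of "\<bar>x\<bar>" "pi/2"] by simp
  moreover have "x \<in> {-pi..<-pi/2} \<union> {pi/2<..pi} \<longleftrightarrow> pi / 2 < \<bar>x\<bar> \<and> \<bar>x\<bar> \<le> pi"
      "x \<in> {-pi..pi} \<longleftrightarrow> \<bar>x\<bar> \<le> pi"
    using pi_gt_zero by (simp_all, linarith+)
  ultimately show "x \<in> {x \<in> {-pi..pi}. cos x < 0} \<longleftrightarrow> x \<in> {-pi..<-pi/2} \<union> {pi/2<..pi}"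
    unfolding mem_Collect_eq by blast
qed

theorem proposition3p12:
  fixes D :: "(real^3) set"
    and \<xi> :: "real^3 \<Rightarrow> complex^'d^'d"
    and l :: "'d \<Rightarrow> real^3 \<Rightarrow> real"
  assumes "bounded D" and "D \<in> sets lebesgue" and "emeasure lebesgue D > 0"
    and "CARD('d) \<in> {1, 2, 3}"
    and "\<xi> \<in> Linf_tensor D"
    and "hermitian_field D \<xi>"
    and "AE x in lebesgue_on D. eigenvalues_of (\<xi> x) (\<lambda>i. complex_of_real (l i x))"
  shows "(elliptic D \<xi> \<longleftrightarrow>
           ((AE x in lebesgue_on D. \<forall>i. l i x > 0) \<or> (AE x in lebesgue_on D. \<forall>i. l i x < 0)) \<and>
           (\<exists>\<xi>\<^sub>p>0. \<exists>\<xi>\<^sub>m>0. AE x in lebesgue_on D. \<forall>i. \<bar>l i x\<bar> \<in> {\<xi>\<^sub>m..\<xi>\<^sub>p})) \<and>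
         (elliptic D \<xi> \<longrightarrow>
           ((AE x in lebesgue_on D. \<forall>i. l i x > 0) \<longrightarrow>
              ellipticity_directions D \<xi> = {-pi/2<..<pi/2}) \<and>
           ((AE x in lebesgue_on D. \<forall>i. l i x < 0) \<longrightarrow>
              ellipticity_directions D \<xi> = {-pi..<-pi/2} \<union> {pi/2<..pi}))"
proof -
  let ?M = "lebesgue_on D"
  let ?pos = "AE x in ?M. \<forall>i. l i x > 0" and ?neg = "AE x in ?M. \<forall>i. l i x < 0"
  note dir = ellipticity_direction_iff[OF assms(6,7)]
  have nontriv: False if "AE x in ?M. False"
    using not_AE_False_lebesgue_on[OF assms(2,3)] that by blast
  \<comment> \<open>Since \<theta> does not depend on \<open>x\<close>, the sign of its cosine is
    imposed on all eigenvalues throughout \<open>D\<close>; mixed signs are impossible.\<close>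
  have sign: "cos \<theta> > 0 \<and> ?pos \<or> cos \<theta> < 0 \<and> ?neg" and
    lower: "\<exists>m>0. AE x in ?M. \<forall>i. m \<le> \<bar>l i x\<bar>"
    if "ellipticity_direction D \<xi> \<theta>" for \<theta>
  proof -
    obtain c where c: "c > 0" "AE x in ?M. \<forall>i. c \<le> cos \<theta> * l i x"
      using \<open>ellipticity_direction D \<xi> \<theta>\<close> dir by blast
    have "AE x in ?M. \<forall>i. l i x > 0" if "cos \<theta> > 0"
      using c(2) by eventually_elim (use c(1) that in \<open>metis order_less_le_trans zero_less_mult_pos\<close>)
    moreover have "AE x in ?M. \<forall>i. l i x < 0" if "cos \<theta> < 0"
      using c(2) by eventually_elim (use c(1) that in \<open>smt (verit) mult_nonpos_nonneg\<close>)
    moreover have "cos \<theta> \<noteq> 0"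
    proof
      assume "cos \<theta> = 0"
      with c show False by (intro nontriv) simp
    qed
    ultimately show "cos \<theta> > 0 \<and> ?pos \<or> cos \<theta> < 0 \<and> ?neg"
      using linorder_neqE_linordered_idom by blast
    have "AE x in ?M. \<forall>i. c \<le> \<bar>l i x\<bar>"
      using c(2)
    proof eventually_elim
      case (elim x)
      \<comment> \<open>As the cosine has modulus at most 1, \<open>c\<close> itself is a lower
        bound for the moduli.\<close>
      have "cos \<theta> * l i x \<le> \<bar>l i x\<bar>" for i
        using mult_right_mono[OF abs_cos_le_one[of \<theta>], of "\<bar>l i x\<bar>"] abs_ge_self[of "cos \<theta> * l i x"]
        by (simp add: abs_mult)
      with elim show ?case
        using order_trans by blast
    qed
    with c(1) show "\<exists>m>0. AE x in ?M. \<forall>i. m \<le> \<bar>l i x\<bar>"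
      by blast
  qed
  have pos_dir: "ellipticity_direction D \<xi> \<theta>"
    if "?pos" "m > 0" "AE x in ?M. \<forall>i. m \<le> \<bar>l i x\<bar>" "cos \<theta> > 0" for m \<theta>
  proof -
    have "AE x in ?M. \<forall>i. cos \<theta> * m \<le> cos \<theta> * l i x"
      using that(1,3) by eventually_elim (use that(4) in \<open>force simp: abs_of_pos\<close>)
    moreover have "cos \<theta> * m > 0"
      using that by simp
    ultimately show ?thesis
      using dir by blast
  qed
  have neg_dir: "ellipticity_direction D \<xi> \<theta>"
    if "?neg" "m > 0" "AE x in ?M. \<forall>i. m \<le> \<bar>l i x\<bar>" "cos \<theta> < 0" for m \<theta>
  proof -
    \<comment> \<open>Both \<open>cos \<theta>\<close> and \<open>l i x\<close> are negative, so the
      positive constant is \<open>- cos \<theta> * m\<close>.\<close>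
    have "AE x in ?M. \<forall>i. - cos \<theta> * m \<le> cos \<theta> * l i x"
      using that(1,3)
    proof eventually_elim
      case (elim x)
      then have "l i x \<le> - m" for i
        by (smt (verit))
      then show ?case
        using that(4) mult_left_mono_neg[of _ "- m" "cos \<theta>"] by simp
    qed
    moreover have "- cos \<theta> * m > 0"
      using that by (simp add: mult_neg_pos)
    ultimately show ?thesis
      using dir by blast
  qed
  have not_both: False if ?pos ?neg
  proof (rule nontriv)
    show "AE x in ?M. False"
      using that by eventually_elim (meson less_asym)
  qed
  have "elliptic D \<xi> \<longleftrightarrow> (?pos \<or> ?neg) \<and>
      (\<exists>\<xi>\<^sub>p>0. \<exists>\<xi>\<^sub>m>0. AE x in ?M. \<forall>i. \<bar>l i x\<bar> \<in> {\<xi>\<^sub>m..\<xi>\<^sub>p})" (is "_ \<longleftrightarrow> _ \<and> ?bounds")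
  proof
    assume "elliptic D \<xi>"
    then obtain \<theta> where \<theta>: "ellipticity_direction D \<xi> \<theta>"
      by (auto simp: elliptic_def)
    obtain m where m: "m > 0" "AE x in ?M. \<forall>i. m \<le> \<bar>l i x\<bar>"
      using lower[OF \<theta>] by blast
    \<comment> \<open>The lower bound came from ellipticity; the upper one comes from essential
      boundedness.\<close>
    obtain C where C: "C > 0" "AE x in ?M. \<forall>i. \<bar>l i x\<bar> \<le> C"
      using Linf_tensor_eigenvalues_bounded[OF assms(5,7)] .
    have "AE x in ?M. \<forall>i. \<bar>l i x\<bar> \<in> {m..C}"
      using m(2) C(2) by eventually_elim simp
    with m(1) C(1) sign[OF \<theta>] show "(?pos \<or> ?neg) \<and> ?bounds"
      by blast
  next
    assume *: "(?pos \<or> ?neg) \<and> ?bounds"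
    then obtain m p where m: "m > 0" "AE x in ?M. \<forall>i. \<bar>l i x\<bar> \<in> {m..p}"
      by blast
    from m(2) have "AE x in ?M. \<forall>i. m \<le> \<bar>l i x\<bar>"
      by eventually_elim simp
    \<comment> \<open>The angles 0 and \<open>pi\<close> have cosines 1 and -1, matching the
      positive and the negative case.\<close>
    with * m(1) have "ellipticity_direction D \<xi> 0 \<or> ellipticity_direction D \<xi> pi"
      using pos_dir[of m 0] neg_dir[of m pi] by auto
    then show "elliptic D \<xi>"
      by (auto simp: elliptic_def)
  qed
  moreover have "ellipticity_directions D \<xi> = {-pi/2<..<pi/2}" if "elliptic D \<xi>" ?pos
  proof -
    obtain \<phi> where "ellipticity_direction D \<xi> \<phi>"
      using \<open>elliptic D \<xi>\<close> unfolding elliptic_def ..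
    from lower[OF this] obtain m where m: "m > 0" "AE x in ?M. \<forall>i. m \<le> \<bar>l i x\<bar>"
      by blast
    \<comment> \<open>The bound \<open>m\<close> obtained from the single direction \<phi> serves
      every \<theta>; conversely \<open>not_both\<close> excludes the opposite sign of the
      cosine.\<close>
    have "ellipticity_direction D \<xi> \<theta> \<longleftrightarrow> 0 < cos \<theta>" for \<theta>
    proof
      show "0 < cos \<theta>" if "ellipticity_direction D \<xi> \<theta>"
        using sign[OF that] not_both \<open>?pos\<close> by argo
    qed (rule pos_dir[OF \<open>?pos\<close> m])
    then show ?thesis
      by (simp only: ellipticity_directions_def cos_pos_interval)
  qed
  moreover have "ellipticity_directions D \<xi> = {-pi..<-pi/2} \<union> {pi/2<..pi}" if "elliptic D \<xi>" ?neg
  proof -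
    obtain \<phi> where "ellipticity_direction D \<xi> \<phi>"
      using \<open>elliptic D \<xi>\<close> unfolding elliptic_def ..
    from lower[OF this] obtain m where m: "m > 0" "AE x in ?M. \<forall>i. m \<le> \<bar>l i x\<bar>"
      by blast
    have "ellipticity_direction D \<xi> \<theta> \<longleftrightarrow> cos \<theta> < 0" for \<theta>
    proof
      show "cos \<theta> < 0" if "ellipticity_direction D \<xi> \<theta>"
        using sign[OF that] not_both \<open>?neg\<close> by argo
    qed (rule neg_dir[OF \<open>?neg\<close> m])
    then show ?thesis
      by (simp only: ellipticity_directions_def cos_neg_interval)
  qed
  ultimately show ?thesis
    by (intro conjI impI)
qed

end
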